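(* Let $P$ be a specification on $(S,\mathcal S)$, let $\mu\in\mathcal G(P)$ be a Markov random field of order $1$, let $\varepsilon\in(0,1)$, and let $\nu_\varepsilon=\prod_{i\in\mathbb Z^2}(\varepsilon\delta_{-1}+(1-\varepsilon)\delta_{+1})$. Let $\mathbb P^\varepsilon$ be the image of $\mu\otimes\nu_\varepsilon$ under the map $S\times S\ni(x^1,x^2)\mapsto x\in S$, $x_i=x^1_i\wedge x^2_i$ for all $i\in\mathbb Z^2$. Let $$\lambda_0^+=\inf_{i\in\mathbb Z^2}\inf_{x\in S}p_i(+1\mid x),\qquad \lambda_0^-=\inf_{i\in\mathbb Z^2}\inf_{x\in S}p_i(-1\mid x),$$ and let $p^*$ be the critical probability for site percolation on $\mathbb Z^2$. If $(1-\varepsilon)\lambda_0^+>1-p^*$, then $$\mathbb P^\varepsilon\Big(\bigcap_{i\in\mathbb Z^2}\{|C_i(X)|<\infty\}\Big)=1.$$ On the other hand, if $\varepsilon+(1-\varepsilon)\lambda_0^->p^*$, then $$\mathbb P^\varepsilon\Big(\bigcup_{i\in\mathbb Z^2}\{|C_i(X)|=\infty\}\Big)>0.$$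
   Context: Let $A=\{-1,1\}$ and $S=A^{\mathbb Z^2}$, with product $\sigma$-algebra $\mathcal S$. For $x\in S$ and $F\subset\mathbb Z^2$, $x_F=(x_i)_{i\in F}$. $X_i(x)=x_i$ are the coordinate projections, $X=(X_i)_{i\in\mathbb Z^2}$, and $\mathcal F_\Lambda=\sigma\{X_i:i\in\Lambda\}$ for $\Lambda\subset\mathbb Z^2$. A random field is a probability measure on $(S,\mathcal S)$. Specification: a family $P=\{P_\Lambda\}$, indexed by finite $\Lambda\subset\mathbb Z^2$, of probability kernels on $(S,\mathcal S)$ such that (a) for each finite $\Lambda$ and $B\in\mathcal S$, $P_\Lambda(B\mid\cdot)$ is $\mathcal F_{\Lambda^c}$-measurable; (b) for each finite $\Lambda$ and $B\in\mathcal F_{\Lambda^c}$, $P_\Lambda(B\mid y)=1_B(y)$; (c) for finite $\Lambda\subset\Delta$, $B\in\mathcal S$ and all $y\in S$, $\int P_\Lambda(B\mid z)P_\Delta(dz\mid y)=P_\Delta(B\mid y)$. Single-site weights: $p_i(a\mid x)=P_{\{i\}}(\{X_i=a\}\mid x)$ for $a\in A$. $\mathcal G(P)$ is the set of random fields $\mu$ with $\int\mu(dx)P_\Lambda(B\mid x)=\mu(B)$ for all finite $\Lambda$ and all $B\in\mathcal S$. $\|i\|_1=|i_1|+|i_2|$; $i,j\in\mathbb Z^2$ are $L^1$-neighbors if $\|i-j\|_1=1$. $\mu\in\mathcal G(P)$ is a Markov random field of order $1$ if for all $i\in\mathbb Z^2$ the function $P_{\{i\}}(\{X_i=+1\}\mid\cdot)$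 is $\mathcal F_{\{j:\|i-j\|_1=1\}}$-measurable. For $F\subset\mathbb Z^2$, $\partial F=\{j\in F:\exists k\in\mathbb Z^2\setminus F,\ \|j-k\|_1=1\}$ and $\mathring F=F\setminus\partial F$. A self-avoiding path is a finite sequence $(i_1,\dots,i_n)$ of sites such that $i_j,i_k$ are $L^1$-neighbors if and only if $|j-k|=1$. $F$ is $L^1$-connected if any two distinct points of $F$ are the first and last points of a self-avoiding path of sites in $F$. Context supports: for $i\in\mathbb Z^2$ and $x\in S$, $$C_i(x)=\Big(\bigcap\{F\subset\mathbb Z^2: i\in\mathring F,\ F\ L^1\text{-connected},\ x_{\partial F}\equiv+1\}\Big)\setminus\{i\}$$ if at least one finite set $F$ satisfies these conditions, and $C_i(x)=\mathbb Z^2\setminus\{i\}$ otherwise. $|C_i(X)|$ denotes cardinality. Site percolation on $\mathbb Z^2$: each site is open independently with probability $p$, with $L^1$-nearest-neighbor connectivity; $p^*$ is the supremum of those $p$ for which there is almost surely no infinite open cluster. *)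

theory Defs
  imports "HOL-Probability.Probability"
begin

type_synonym site = "int \<times> int"
type_synonym config = "site \<Rightarrow> int"

definition spins :: "int set" where
  "spins = {-1, 1}"

definition config_space :: "config measure" where
  "config_space = (\<Pi>\<^sub>M i\<in>UNIV. count_space spins)"

abbreviation configs :: "config set" where
  "configs \<equiv> space config_space"

definition coord_algebra :: "site set \<Rightarrow> config measure" where
  "coord_algebra L = sigma configs {{x \<in> configs. x i \<in> B} |i B. i \<in> L \<and> B \<subseteq> spins}"


subsection \<open>Gibbsian specifications and random fields\<close>

text \<open>The measure \<open>P L x\<close> stands for \<open>P\<^sub>L(\<cdot> | x)\<close>. Its values for infinite \<open>L\<close> or for
  \<open>x\<close> outside \<^term>\<open>configs\<close> are irrelevant.\<close>

definition gibbs_spec :: "(site set \<Rightarrow> config \<Rightarrow> config measure) \<Rightarrow> bool" where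
  "gibbs_spec P \<longleftrightarrow>
     (\<forall>L. finite L \<longrightarrow> P L \<in> config_space \<rightarrow>\<^sub>M prob_algebra config_space) \<and>
     (\<forall>L. finite L \<longrightarrow> (\<forall>B\<in>sets config_space.
        (\<lambda>x. measure (P L x) B) \<in> borel_measurable (coord_algebra (- L)))) \<and>
     (\<forall>L. finite L \<longrightarrow> (\<forall>B\<in>sets (coord_algebra (- L)). \<forall>y\<in>configs.
        measure (P L y) B = indicator B y)) \<and>
     (\<forall>L D. finite D \<longrightarrow> L \<subseteq> D \<longrightarrow> (\<forall>B\<in>sets config_space. \<forall>y\<in>configs.
        (\<integral>z. measure (P L z) B \<partial>(P D y)) = measure (P D y) B))"

definition single_site :: "(site set \<Rightarrow> config \<Rightarrow> config measure) \<Rightarrow> site \<Rightarrow> int \<Rightarrow> config \<Rightarrow> real" where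
  "single_site P i a x = measure (P {i} x) {y \<in> configs. y i = a}"

definition gibbs_measures :: "(site set \<Rightarrow> config \<Rightarrow> config measure) \<Rightarrow> config measure set" where
  "gibbs_measures P = {\<mu> \<in> space (prob_algebra config_space).
     \<forall>L. finite L \<longrightarrow> (\<forall>B\<in>sets config_space. (\<integral>x. measure (P L x) B \<partial>\<mu>) = measure \<mu> B)}"

definition l1_norm :: "site \<Rightarrow> int" where
  "l1_norm i = \<bar>fst i\<bar> + \<bar>snd i\<bar>"

definition l1_neighbors :: "site \<Rightarrow> site \<Rightarrow> bool" where
  "l1_neighbors i j \<longleftrightarrow> l1_norm (i - j) = 1"

definition markov_field_order1 ::
    "(site set \<Rightarrow> config \<Rightarrow> config measure) \<Rightarrow> config measure \<Rightarrow> bool" where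
  "markov_field_order1 P \<mu> \<longleftrightarrow> \<mu> \<in> gibbs_measures P \<and>
     (\<forall>i. single_site P i 1 \<in> borel_measurable (coord_algebra {j. l1_neighbors i j}))"

definition lambda0 :: "(site set \<Rightarrow> config \<Rightarrow> config measure) \<Rightarrow> int \<Rightarrow> real" where
  "lambda0 P a = (INF i. INF x\<in>configs. single_site P i a x)"


subsection \<open>Random dilution\<close>

definition noise :: "real \<Rightarrow> config measure" where
  "noise \<epsilon> = (\<Pi>\<^sub>M i\<in>UNIV. point_measure spins (\<lambda>a. if a = -1 then ennreal \<epsilon> else ennreal (1 - \<epsilon>)))"

definition diluted :: "config measure \<Rightarrow> real \<Rightarrow> config measure" where
  "diluted \<mu> \<epsilon> = distr (\<mu> \<Otimes>\<^sub>M noise \<epsilon>) config_space (\<lambda>(x1, x2) i. min (x1 i) (x2 i))"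


subsection \<open>Context supports\<close>

definition site_boundary :: "site set \<Rightarrow> site set" where
  "site_boundary F = {j \<in> F. \<exists>k. k \<notin> F \<and> l1_neighbors j k}"

definition site_interior :: "site set \<Rightarrow> site set" where
  "site_interior F = F - site_boundary F"

definition self_avoiding :: "site list \<Rightarrow> bool" where
  "self_avoiding p \<longleftrightarrow>
     (\<forall>j<length p. \<forall>k<length p. l1_neighbors (p ! j) (p ! k) \<longleftrightarrow> \<bar>int j - int k\<bar> = 1)"

definition l1_connected :: "site set \<Rightarrow> bool" where
  "l1_connected F \<longleftrightarrow> (\<forall>a\<in>F. \<forall>b\<in>F. a \<noteq> b \<longrightarrow>
     (\<exists>p. p \<noteq> [] \<and> self_avoiding p \<and> set p \<subseteq> F \<and> hd p = a \<and> last p = b))"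

definition context_sets :: "site \<Rightarrow> config \<Rightarrow> site set set" where
  "context_sets i x =
     {F. i \<in> site_interior F \<and> l1_connected F \<and> (\<forall>j\<in>site_boundary F. x j = 1)}"

definition context_support :: "site \<Rightarrow> config \<Rightarrow> site set" where
  "context_support i x =
     (if \<exists>F\<in>context_sets i x. finite F then \<Inter>(context_sets i x) - {i} else UNIV - {i})"


subsection \<open>Site percolation\<close>

definition percolation :: "real \<Rightarrow> (site \<Rightarrow> bool) measure" where
  "percolation p = (\<Pi>\<^sub>M i\<in>UNIV. measure_pmf (bernoulli_pmf p))"

definition open_cluster :: "(site \<Rightarrow> bool) \<Rightarrow> site \<Rightarrow> site set" where
  "open_cluster \<omega> i = {j. (i, j) \<in> {(k, l). \<omega> k \<and> \<omega> l \<and> l1_neighbors k l}\<^sup>*}"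

definition p_crit :: real where
  "p_crit = Sup {p \<in> {0..1}. AE \<omega> in percolation p. \<not> (\<exists>i. \<omega> i \<and> infinite (open_cluster \<omega> i))}"

end

theory Submission
  imports Defs
begin

text \<open>The set \<open>C\<^sub>i(x)\<close> is finite iff the cluster of \<open>-1\<close>s containing \<open>i\<close> (with \<open>i\<close> itself counted
  as \<open>-1\<close>) is finite: an admissible \<open>F\<close> must contain that cluster in its interior, and conversely the
  cluster together with its neighbours is admissible. Conditionally on all other sites, a site
  carries \<open>-1\<close> after dilution with probability at most \<open>1 - (1 - \<epsilon>) \<lambda>\<^sub>0\<^sup>+\<close> and at least
  \<open>\<epsilon> + (1 - \<epsilon>) \<lambda>\<^sub>0\<^sup>-\<close>, so the field of \<open>-1\<close>s is stochastically compared with Bernoulli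
  percolation, first on events depending on finitely many sites and then, by monotone limits, on
  the event that a cluster is infinite.\<close>

section \<open>Context supports and clusters\<close>

lemma l1_neighbors_sym: "l1_neighbors i j \<longleftrightarrow> l1_neighbors j i"
  by (auto simp: l1_neighbors_def l1_norm_def)

lemma l1_neighbors_irrefl: "\<not> l1_neighbors i i"
  by (simp add: l1_neighbors_def l1_norm_def)

lemma finite_l1_neighbors: "finite {j. l1_neighbors i j}"
proof (rule finite_subset)
  show "{j. l1_neighbors i j} \<subseteq> {fst i - 1..fst i + 1} \<times> {snd i - 1..snd i + 1}"
    by (auto simp: l1_neighbors_def l1_norm_def)
qed simp

definition walk :: "site list \<Rightarrow> bool" where
  "walk p \<longleftrightarrow> (\<forall>j. Suc j < length p \<longrightarrow> l1_neighbors (p ! j) (p ! Suc j))"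

lemma walk_shortcut:
  assumes "walk p" "j < k" "k < length p" "l1_neighbors (p ! j) (p ! k)"
  shows "walk (take (Suc j) p @ drop k p)"
  unfolding walk_def
proof (intro allI impI)
  fix n assume n: "Suc n < length (take (Suc j) p @ drop k p)"
  consider "n < j" | "n = j" | "n > j" by linarith
  then show "l1_neighbors ((take (Suc j) p @ drop k p) ! n) ((take (Suc j) p @ drop k p) ! Suc n)"
  proof cases
    case 1 then show ?thesis using assms by (auto simp: nth_append walk_def)
  next
    case 2 then show ?thesis using assms by (auto simp: nth_append)
  next
    case 3
    have "l1_neighbors (p ! (k + (n - Suc j))) (p ! Suc (k + (n - Suc j)))"
      using assms n 3 by (auto simp: walk_def)
    moreover have "Suc (k + (n - Suc j)) = k + (n - j)" using 3 by simp
    ultimately show ?thesis using assms n 3 by (auto simp: nth_append)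
  qed
qed

lemma walk_imp_self_avoiding:
  assumes "walk p" "p \<noteq> []" "set p \<subseteq> F"
  shows "\<exists>q. q \<noteq> [] \<and> self_avoiding q \<and> set q \<subseteq> F \<and> hd q = hd p \<and> last q = last p"
  using assms
proof (induction "length p" arbitrary: p rule: less_induct)
  case less
  show ?case
  proof (cases "self_avoiding p")
    case True then show ?thesis using less.prems by blast
  next
    case False
    then obtain j k where jk: "j < length p" "k < length p"
      "l1_neighbors (p ! j) (p ! k) \<noteq> (\<bar>int j - int k\<bar> = 1)"
      unfolding self_avoiding_def by blast
    have step: "l1_neighbors (p ! a) (p ! b)" if "\<bar>int a - int b\<bar> = 1" "a < length p" "b < length p" for a b
    proof -
      from that consider "b = Suc a" | "a = Suc b" by linarith
      then show ?thesis using that less.prems(1) l1_neighbors_sym by cases (auto simp: walk_def)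
    qed
    with jk have nb: "l1_neighbors (p ! j) (p ! k)" "\<bar>int j - int k\<bar> \<noteq> 1" by auto
    obtain a b where ab: "Suc a < b" "b < length p" "l1_neighbors (p ! a) (p ! b)"
    proof -
      consider "j = k" | "Suc j < k" | "Suc k < j" using nb(2) by linarith
      then show thesis
        using nb(1) jk(1,2) that l1_neighbors_irrefl l1_neighbors_sym by cases auto
    qed
    let ?q = "take (Suc a) p @ drop b p"
    have 1: "length ?q < length p" using ab by auto
    have 2: "walk ?q" using walk_shortcut[OF less.prems(1), of a b] ab by auto
    have 3: "?q \<noteq> []" "hd ?q = hd p" "last ?q = last p"
      using ab less.prems(2) by (auto simp: hd_append)
    have 4: "set ?q \<subseteq> F"
      using less.prems(3) set_take_subset[of "Suc a" p] set_drop_subset[of b p] by auto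
    from less.hyps[OF 1 2 3(1) 4] 3 show ?thesis by simp
  qed
qed

lemma rtrancl_imp_walk:
  assumes "(a, b) \<in> {(k, l). k \<in> F \<and> l \<in> F \<and> l1_neighbors k l}\<^sup>*" "a \<in> F"
  shows "\<exists>p. p \<noteq> [] \<and> walk p \<and> set p \<subseteq> F \<and> hd p = a \<and> last p = b"
  using assms(1)
proof (induction rule: rtrancl_induct)
  case base
  have "[a] \<noteq> [] \<and> walk [a] \<and> set [a] \<subseteq> F \<and> hd [a] = a \<and> last [a] = a"
    using assms(2) by (simp add: walk_def)
  then show ?case by blast
next
  case (step y z)
  then obtain p where p: "p \<noteq> []" "walk p" "set p \<subseteq> F" "hd p = a" "last p = y" by blast
  have "walk (p @ [z])"
    unfolding walk_def
  proof (intro allI impI)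
    fix n assume n: "Suc n < length (p @ [z])"
    show "l1_neighbors ((p @ [z]) ! n) ((p @ [z]) ! Suc n)"
    proof (cases "Suc n < length p")
      case True then show ?thesis using p(2) by (auto simp: walk_def nth_append)
    next
      case False
      then have "n = length p - 1" using n p(1) by (cases p) auto
      then show ?thesis using p step.hyps by (auto simp: nth_append last_conv_nth)
    qed
  qed
  then have "p @ [z] \<noteq> [] \<and> walk (p @ [z]) \<and> set (p @ [z]) \<subseteq> F \<and> hd (p @ [z]) = a \<and> last (p @ [z]) = z"
    using p step.hyps by auto
  then show ?case by blast
qed

lemma l1_connectedI:
  assumes "\<And>a. a \<in> F \<Longrightarrow> (i, a) \<in> {(k, l). k \<in> F \<and> l \<in> F \<and> l1_neighbors k l}\<^sup>*"
  shows "l1_connected F"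
  unfolding l1_connected_def
proof (intro ballI impI)
  fix a b assume ab: "a \<in> F" "b \<in> F"
  let ?R = "{(k, l). k \<in> F \<and> l \<in> F \<and> l1_neighbors k l}"
  have "sym ?R" using l1_neighbors_sym by (auto simp: sym_def)
  then have "(a, i) \<in> ?R\<^sup>*" using assms[OF ab(1)] by (meson sym_rtrancl symE)
  then have "(a, b) \<in> ?R\<^sup>*" using assms[OF ab(2)] by (rule rtrancl_trans)
  from rtrancl_imp_walk[OF this ab(1)] walk_imp_self_avoiding
  show "\<exists>p. p \<noteq> [] \<and> self_avoiding p \<and> set p \<subseteq> F \<and> hd p = a \<and> last p = b" by metis
qed

lemma open_cluster_mono:
  assumes "\<And>j. w j \<Longrightarrow> v j"
  shows "open_cluster w i \<subseteq> open_cluster v i"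
  unfolding open_cluster_def using assms by (auto elim!: rtrancl_mono[THEN subsetD, rotated])

lemma open_cluster_open: "j \<in> open_cluster w i \<Longrightarrow> j \<noteq> i \<Longrightarrow> w j"
  unfolding open_cluster_def by (auto elim: rtranclE)

lemma infinite_open_cluster_open:
  assumes "infinite (open_cluster w i)"
  shows "w i"
proof (rule ccontr)
  assume "\<not> w i"
  then have "open_cluster w i \<subseteq> {i}"
    unfolding open_cluster_def by (auto elim: converse_rtranclE)
  then show False using assms finite_subset by blast
qed

lemma open_cluster_step:
  "j \<in> open_cluster w i \<Longrightarrow> w j \<Longrightarrow> w k \<Longrightarrow> l1_neighbors j k \<Longrightarrow> k \<in> open_cluster w i"
  unfolding open_cluster_def by (auto intro: rtrancl.rtrancl_into_rtrancl)

lemma open_cluster_refl: "i \<in> open_cluster w i"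
  by (simp add: open_cluster_def)

lemma open_cluster_force_open:
  "open_cluster (w(i := True)) i \<subseteq> insert i (\<Union>j\<in>{j. l1_neighbors i j}. open_cluster w j)"
proof
  fix k assume "k \<in> open_cluster (w(i := True)) i"
  then have "(i, k) \<in> {(k, l). (w(i := True)) k \<and> (w(i := True)) l \<and> l1_neighbors k l}\<^sup>*"
    by (simp add: open_cluster_def)
  then show "k \<in> insert i (\<Union>j\<in>{j. l1_neighbors i j}. open_cluster w j)"
  proof (induction rule: rtrancl_induct)
    case (step y z)
    show ?case
    proof (cases "y = i \<or> z = i")
      case True
      then have "z = i \<or> l1_neighbors i z" using step.hyps by auto
      then show ?thesis using open_cluster_refl by blast
    next
      case False
      then have "w y" "w z" "l1_neighbors y z" using step.hyps by auto
      then show ?thesis using step.IH False open_cluster_step by blast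
    qed
  qed simp
qed

definition minus_sites :: "config \<Rightarrow> site \<Rightarrow> bool" where
  "minus_sites x j \<longleftrightarrow> x j = -1"

lemma configs_iff: "x \<in> configs \<longleftrightarrow> (\<forall>i. x i = -1 \<or> x i = 1)"
  by (auto simp: config_space_def space_PiM PiE_iff spins_def)

lemma infinite_context_support_iff:
  assumes "x \<in> configs"
  shows "infinite (context_support i x) \<longleftrightarrow> infinite (open_cluster ((minus_sites x)(i := True)) i)"
proof -
  let ?w = "(minus_sites x)(i := True)"
  let ?K = "open_cluster ?w i"
  have "finite ?K" if F: "F \<in> context_sets i x" "finite F" for F
  proof (rule finite_subset[OF _ F(2)])
    have "k \<in> site_interior F" if "k \<in> ?K" for k
      using that unfolding open_cluster_def mem_Collect_eq
    proof (induction rule: rtrancl_induct)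
      case base then show ?case using F by (simp add: context_sets_def)
    next
      case (step y z)
      then have "z \<in> F" unfolding site_interior_def site_boundary_def by blast
      then show ?case using step F
        by (auto simp: site_interior_def context_sets_def minus_sites_def split: if_splits)
    qed
    then show "?K \<subseteq> F" by (auto simp: site_interior_def)
  qed
  moreover have "\<exists>F\<in>context_sets i x. finite F" if "finite ?K"
  proof -
    define F where "F = ?K \<union> (\<Union>k\<in>?K. {j. l1_neighbors k j})"
    let ?R = "{(k, l). k \<in> F \<and> l \<in> F \<and> l1_neighbors k l}"
    have fin: "finite F" using that finite_l1_neighbors by (auto simp: F_def)
    have int: "?K \<subseteq> site_interior F"
      by (auto simp: F_def site_interior_def site_boundary_def)
    have K: "(i, a) \<in> ?R\<^sup>*" if "a \<in> ?K" for a
      using that[unfolded open_cluster_def mem_Collect_eq]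
    proof (induction rule: rtrancl_induct)
      case (step y z)
      have "y \<in> ?K" using step.hyps(1) by (simp add: open_cluster_def)
      moreover from this have "z \<in> ?K" using step.hyps(2) open_cluster_step by blast
      ultimately show ?case using step by (auto simp: F_def intro: rtrancl.rtrancl_into_rtrancl)
    qed simp
    have "l1_connected F"
    proof (rule l1_connectedI)
      fix a assume a: "a \<in> F"
      show "(i, a) \<in> ?R\<^sup>*"
      proof (cases "a \<in> ?K")
        case False
        with a obtain k where k: "k \<in> ?K" "l1_neighbors k a" by (auto simp: F_def)
        then have "(k, a) \<in> ?R" using a by (auto simp: F_def)
        with K[OF k(1)] show ?thesis by (rule rtrancl.rtrancl_into_rtrancl)
      qed (rule K)
    qed
    moreover have "x j = 1" if j: "j \<in> site_boundary F" for j
    proof (rule ccontr)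
      assume "x j \<noteq> 1"
      then have "?w j" using assms[unfolded configs_iff, rule_format, of j] by (simp add: minus_sites_def)
      moreover have "j \<notin> ?K" "j \<in> F" using j int by (auto simp: site_interior_def site_boundary_def)
      moreover from this obtain k where k: "k \<in> ?K" "l1_neighbors k j" by (auto simp: F_def)
      moreover have "?w k" using open_cluster_open[OF k(1)] by auto
      ultimately show False using open_cluster_step by blast
    qed
    moreover have "i \<in> site_interior F" using int open_cluster_refl by blast
    ultimately show ?thesis using fin unfolding context_sets_def by blast
  qed
  moreover have "finite (context_support i x) \<longleftrightarrow> (\<exists>F\<in>context_sets i x. finite F)"
    unfolding context_support_def
    by (auto simp: infinite_UNIV_char_0 finite_prod intro: finite_subset[OF Inter_lower])
  ultimately show ?thesis by blast
qed

section \<open>Stochastic domination\<close>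

abbreviation site_fields :: "('i \<Rightarrow> bool) measure" where
  "site_fields \<equiv> (\<Pi>\<^sub>M i\<in>UNIV. count_space UNIV)"

definition insensitive :: "'i \<Rightarrow> 'a set \<Rightarrow> ('i \<Rightarrow> 'a) set \<Rightarrow> bool" where
  "insensitive i A B \<longleftrightarrow> (\<forall>x\<in>B. \<forall>a\<in>A. x(i := a) \<in> B)"

definition opens_at_most :: "real \<Rightarrow> ('i \<Rightarrow> bool) measure \<Rightarrow> bool" where
  "opens_at_most p m \<longleftrightarrow> prob_space m \<and> sets m = sets site_fields \<and>
     (\<forall>i. \<forall>C\<in>sets m. insensitive i UNIV C \<longrightarrow> measure m ({w. w i} \<inter> C) \<le> p * measure m C)"

definition opens_at_least :: "real \<Rightarrow> ('i \<Rightarrow> bool) measure \<Rightarrow> bool" where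
  "opens_at_least p m \<longleftrightarrow> prob_space m \<and> sets m = sets site_fields \<and>
     (\<forall>i. \<forall>C\<in>sets m. insensitive i UNIV C \<longrightarrow> p * measure m C \<le> measure m ({w. w i} \<inter> C))"

definition determined_by :: "'i set \<Rightarrow> ('i \<Rightarrow> bool) set \<Rightarrow> bool" where
  "determined_by L E \<longleftrightarrow> (\<forall>v w. (\<forall>j\<in>L. v j = w j) \<longrightarrow> v \<in> E \<longrightarrow> w \<in> E)"

definition increasing_event :: "('i \<Rightarrow> bool) set \<Rightarrow> bool" where
  "increasing_event E \<longleftrightarrow> (\<forall>v w. (\<forall>j. v j \<longrightarrow> w j) \<longrightarrow> v \<in> E \<longrightarrow> w \<in> E)"

lemma space_site_fields: "space site_fields = UNIV"
  by (auto simp: space_PiM)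

lemma site_open_measurable: "{w. w i} \<in> sets site_fields"
proof -
  have "{w \<in> space site_fields. w i} \<in> sets site_fields" by measurable
  then show ?thesis by (simp add: space_site_fields)
qed

lemma determined_by_measurable:
  assumes "finite L" "determined_by L E"
  shows "E \<in> sets site_fields"
proof -
  have "E = (\<Union>A\<in>{A\<in>Pow L. (\<lambda>j. j \<in> A) \<in> E}. {w. \<forall>j\<in>L. w j \<longleftrightarrow> j \<in> A})" (is "_ = ?U")
  proof (intro equalityI subsetI)
    fix w assume "w \<in> E"
    then have "(\<lambda>j. j \<in> {j\<in>L. w j}) \<in> E"
      by (rule assms(2)[unfolded determined_by_def, rule_format, rotated]) auto
    then show "w \<in> ?U" by (intro UN_I[of "{j\<in>L. w j}"]) auto
  next
    fix w assume "w \<in> ?U"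
    then obtain A where A: "(\<lambda>j. j \<in> A) \<in> E" "\<forall>j\<in>L. w j \<longleftrightarrow> j \<in> A" by auto
    show "w \<in> E" using A(2)
      by (intro assms(2)[unfolded determined_by_def, rule_format, OF _ A(1)]) auto
  qed
  moreover have "{w. \<forall>j\<in>L. w j \<longleftrightarrow> j \<in> A} \<in> sets site_fields" for A
  proof -
    have "{w \<in> space site_fields. \<forall>j\<in>L. w j \<longleftrightarrow> j \<in> A} \<in> sets site_fields"
      using assms(1) by measurable
    then show ?thesis by (simp add: space_site_fields)
  qed
  moreover have "finite {A\<in>Pow L. (\<lambda>j. j \<in> A) \<in> E}" using assms(1) by simp
  ultimately show ?thesis by (metis (no_types, lifting) sets.finite_UN)
qed

text \<open>The factor \<open>C\<close> carries the already revealed coordinates through the induction on \<open>L\<close>.\<close>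

lemma domination_finite:
  assumes m: "opens_at_most p m" and m': "opens_at_least p m'"
    and "finite L" "increasing_event E" "determined_by L E"
    and "C \<in> sets m" "\<And>j. j \<in> L \<Longrightarrow> insensitive j UNIV C"
  shows "measure m (E \<inter> C) \<le> measure m' E * measure m C"
  using assms(3-)
proof (induction L arbitrary: E C rule: finite_induct)
  case empty
  interpret m': prob_space m' using m' by (simp add: opens_at_least_def)
  have "space m' = UNIV"
    using m' by (metis opens_at_least_def sets_eq_imp_space_eq space_site_fields)
  then have "measure m' UNIV = 1" using m'.prob_space by simp
  moreover have "E = {} \<or> E = UNIV" using empty by (auto simp: determined_by_def)
  ultimately show ?case by auto
next
  case (insert i L)
  interpret m: prob_space m using m by (simp add: opens_at_most_def)
  interpret m': prob_space m' using m' by (simp add: opens_at_least_def)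
  have sm: "sets m = sets site_fields" "sets m' = sets site_fields"
    using m m' by (auto simp: opens_at_most_def opens_at_least_def)
  let ?O = "{w. w i}"
  define E1 where "E1 = {w. w(i := True) \<in> E}"
  define E0 where "E0 = {w. w(i := False) \<in> E}"
  have incE: "v \<in> E \<Longrightarrow> (\<And>j. v j \<Longrightarrow> w j) \<Longrightarrow> w \<in> E" for v w
    using insert.prems(1) by (auto simp: increasing_event_def)
  have detE: "v \<in> E \<Longrightarrow> (\<And>j. j \<in> insert i L \<Longrightarrow> v j = w j) \<Longrightarrow> w \<in> E" for v w
    using insert.prems(2) unfolding determined_by_def by blast
  have inc: "increasing_event E1" "increasing_event E0"
    unfolding increasing_event_def E1_def E0_def mem_Collect_eq
    by (intro allI impI; erule incE; simp split: if_splits)+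
  have det: "determined_by L E1" "determined_by L E0"
    unfolding determined_by_def E1_def E0_def mem_Collect_eq
    by (intro allI impI; erule detE; auto)+
  have sub: "E0 \<subseteq> E1" unfolding E1_def E0_def
    by (intro Collect_mono impI; erule incE; simp split: if_splits)
  have E01: "E0 \<in> sets site_fields" "E1 \<in> sets site_fields"
    using det insert.hyps(1) determined_by_measurable by blast+
  have C: "C \<in> sets site_fields" using insert.prems(3) sm by simp
  have O: "?O \<in> sets site_fields" by (rule site_open_measurable)
  have upd: "w(i := w i) = w" for w :: "'a \<Rightarrow> bool" by simp
  have Esplit: "w \<in> E \<longleftrightarrow> (if w i then w \<in> E1 else w \<in> E0)" for w
    unfolding E1_def E0_def by (cases "w i") (use upd[of w] in auto)
  have sens: "insensitive j UNIV (C \<inter> ?O)" "insensitive j UNIV (C - ?O)" if "j \<in> L" for j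
    using insert.prems(4)[of j] that insert.hyps(2) by (auto simp: insensitive_def)
  let ?a = "measure m (C \<inter> ?O)" and ?c = "measure m C"
  have split: "measure m (C - ?O) = ?c - ?a"
    using m.finite_measure_Diff'[of C ?O] C O sm by simp
  have "measure m (E \<inter> C) = measure m ((E1 \<inter> (C \<inter> ?O)) \<union> (E0 \<inter> (C - ?O)))"
    by (rule arg_cong[where f = "measure m"]) (auto simp: Esplit split: if_splits)
  also have "\<dots> = measure m (E1 \<inter> (C \<inter> ?O)) + measure m (E0 \<inter> (C - ?O))"
    by (rule m.finite_measure_Union) (use C O E01 sm in auto)
  also have "\<dots> \<le> measure m' E1 * ?a + measure m' E0 * (?c - ?a)"
    using insert.IH[OF inc(1) det(1), of "C \<inter> ?O"] insert.IH[OF inc(2) det(2), of "C - ?O"]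
      sens C O sm split by auto
  also have "\<dots> = measure m' E0 * ?c + (measure m' E1 - measure m' E0) * ?a"
    by (simp add: algebra_simps)
  also have "\<dots> \<le> measure m' E0 * ?c + (measure m' E1 - measure m' E0) * (p * ?c)"
  proof -
    have "?a \<le> p * ?c"
      using m insert.prems(3,4) unfolding opens_at_most_def by (simp add: Int_commute)
    moreover have "measure m' E0 \<le> measure m' E1"
      using sub E01 sm by (intro m'.finite_measure_mono) auto
    ultimately show ?thesis by (intro add_left_mono mult_left_mono) auto
  qed
  also have "\<dots> = (measure m' E0 + p * measure m' (E1 - E0)) * ?c"
  proof -
    have diff: "measure m' (E1 - E0) = measure m' E1 - measure m' E0"
      using m'.finite_measure_Diff[of E1 E0] sub E01 sm by simp
    show ?thesis unfolding diff by (simp add: algebra_simps)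
  qed
  also have "\<dots> \<le> measure m' E * ?c"
  proof (rule mult_right_mono)
    have "insensitive i UNIV (E1 - E0)" by (auto simp: insensitive_def E1_def E0_def)
    then have "p * measure m' (E1 - E0) \<le> measure m' (?O \<inter> (E1 - E0))"
      using m' E01 sm unfolding opens_at_least_def by auto
    then have "measure m' E0 + p * measure m' (E1 - E0)
        \<le> measure m' E0 + measure m' (?O \<inter> (E1 - E0))" by simp
    also have "\<dots> = measure m' (E0 \<union> (?O \<inter> (E1 - E0)))"
      by (rule m'.finite_measure_Union[symmetric]) (use O E01 sm in auto)
    also have "E0 \<union> (?O \<inter> (E1 - E0)) = E" using sub by (auto simp: Esplit split: if_splits)
    finally show "measure m' E0 + p * measure m' (E1 - E0) \<le> measure m' E" .
  qed simp
  finally show ?case .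
qed

definition truncated_cluster :: "(site \<Rightarrow> bool) \<Rightarrow> site \<Rightarrow> nat \<Rightarrow> site set" where
  "truncated_cluster w i k = open_cluster (\<lambda>j. w j \<and> to_nat j < k) i"

definition large_cluster_event :: "site \<Rightarrow> nat \<Rightarrow> nat \<Rightarrow> (site \<Rightarrow> bool) set" where
  "large_cluster_event i n k = {w. n \<le> card (truncated_cluster w i k)}"

lemma finite_to_nat_less: "finite {j::'a::countable. to_nat j < k}"
  using finite_vimageI[of "{..<k}" "to_nat :: 'a \<Rightarrow> nat"] by (simp add: vimage_def)

lemma finite_truncated_cluster: "finite (truncated_cluster w i k)"
proof (rule finite_subset)
  show "truncated_cluster w i k \<subseteq> insert i {j. to_nat j < k}"
    unfolding truncated_cluster_def using open_cluster_open by blast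
qed (simp add: finite_to_nat_less)

lemma truncated_cluster_mono:
  "(\<And>j. v j \<Longrightarrow> w j) \<Longrightarrow> k \<le> l \<Longrightarrow> truncated_cluster v i k \<subseteq> truncated_cluster w i l"
  unfolding truncated_cluster_def by (intro open_cluster_mono) auto

lemma open_cluster_eq_UN_truncated: "open_cluster w i = (\<Union>k. truncated_cluster w i k)"
proof
  show "(\<Union>k. truncated_cluster w i k) \<subseteq> open_cluster w i"
    unfolding truncated_cluster_def by (intro UN_least open_cluster_mono) auto
  show "open_cluster w i \<subseteq> (\<Union>k. truncated_cluster w i k)"
  proof
    fix j assume "j \<in> open_cluster w i"
    then have "(i, j) \<in> {(k, l). w k \<and> w l \<and> l1_neighbors k l}\<^sup>*"
      by (simp add: open_cluster_def)
    then show "j \<in> (\<Union>k. truncated_cluster w i k)"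
    proof (induction rule: rtrancl_induct)
      case base
      show ?case using open_cluster_refl unfolding truncated_cluster_def by blast
    next
      case (step y z)
      then obtain k where k: "y \<in> truncated_cluster w i k" by blast
      define l where "l = Suc (max k (max (to_nat y) (to_nat z)))"
      have "k \<le> l" "to_nat y < l" "to_nat z < l" by (auto simp: l_def)
      then have "y \<in> truncated_cluster w i l" using truncated_cluster_mono[of w w k l i] k by blast
      then have "z \<in> truncated_cluster w i l"
        using step.hyps \<open>to_nat y < l\<close> \<open>to_nat z < l\<close>
        unfolding truncated_cluster_def by (auto intro: open_cluster_step)
      then show ?case by blast
    qed
  qed
qed

lemma infinite_open_cluster_iff:
  "infinite (open_cluster w i) \<longleftrightarrow> (\<forall>n. \<exists>k. n \<le> card (truncated_cluster w i k))"
proof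
  assume inf: "infinite (open_cluster w i)"
  show "\<forall>n. \<exists>k. n \<le> card (truncated_cluster w i k)"
  proof
    fix n
    obtain T where T: "finite T" "card T = n" "T \<subseteq> open_cluster w i"
      using infinite_arbitrarily_large[OF inf] by blast
    have "\<exists>k. T \<subseteq> truncated_cluster w i k"
      using T(1,3)
    proof (induction T rule: finite_induct)
      case (insert t T)
      then obtain k l where kl: "T \<subseteq> truncated_cluster w i k" "t \<in> truncated_cluster w i l"
        by (auto simp: open_cluster_eq_UN_truncated)
      then have "insert t T \<subseteq> truncated_cluster w i (max k l)"
        using truncated_cluster_mono[of w w k "max k l" i] truncated_cluster_mono[of w w l "max k l" i]
        by auto
      then show ?case by blast
    qed simp
    then show "\<exists>k. n \<le> card (truncated_cluster w i k)"
      using T(2) card_mono[OF finite_truncated_cluster] by blast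
  qed
next
  assume *: "\<forall>n. \<exists>k. n \<le> card (truncated_cluster w i k)"
  show "infinite (open_cluster w i)"
  proof
    assume fin: "finite (open_cluster w i)"
    obtain k where "Suc (card (open_cluster w i)) \<le> card (truncated_cluster w i k)" using * by blast
    moreover have "card (truncated_cluster w i k) \<le> card (open_cluster w i)"
      by (rule card_mono[OF fin]) (auto simp: open_cluster_eq_UN_truncated)
    ultimately show False by simp
  qed
qed

lemma infinite_cluster_event:
  "{w. infinite (open_cluster w i)} = (\<Inter>n. \<Union>k. large_cluster_event i n k)"
  by (auto simp: infinite_open_cluster_iff large_cluster_event_def)

lemma increasing_large_cluster: "increasing_event (large_cluster_event i n k)"
  unfolding increasing_event_def
proof (intro allI impI)
  fix v w assume "\<forall>j. v j \<longrightarrow> w j" "v \<in> large_cluster_event i n k"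
  then show "w \<in> large_cluster_event i n k"
    using card_mono[OF finite_truncated_cluster truncated_cluster_mono[of v w k k i]]
    by (auto simp: large_cluster_event_def)
qed

lemma determined_large_cluster: "determined_by {j. to_nat j < k} (large_cluster_event i n k)"
  unfolding determined_by_def
proof (intro allI impI)
  fix v w assume "\<forall>j\<in>{j. to_nat j < k}. v j = w j" "v \<in> large_cluster_event i n k"
  moreover from this have "(\<lambda>j. v j \<and> to_nat j < k) = (\<lambda>j. w j \<and> to_nat j < k)" by auto
  ultimately show "w \<in> large_cluster_event i n k"
    by (simp add: large_cluster_event_def truncated_cluster_def)
qed

lemma large_cluster_measurable: "large_cluster_event i n k \<in> sets site_fields"
  using determined_by_measurable[OF finite_to_nat_less determined_large_cluster] .

lemma infinite_cluster_measurable: "{w. infinite (open_cluster w i)} \<in> sets site_fields"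
proof -
  have "UNIV \<in> sets site_fields" by (metis sets.top space_site_fields)
  then show ?thesis
    unfolding infinite_cluster_event
    by (intro sets.countable_INT'' sets.countable_UN) (auto intro: large_cluster_measurable)
qed

lemma infinite_cluster_domination:
  assumes m: "opens_at_most p m" and m': "opens_at_least p m'"
  shows "measure m {w. infinite (open_cluster w i)} \<le> measure m' {w. infinite (open_cluster w i)}"
proof -
  interpret m: prob_space m using m by (simp add: opens_at_most_def)
  interpret m': prob_space m' using m' by (simp add: opens_at_least_def)
  have sm: "sets m = sets site_fields" "sets m' = sets site_fields"
    using m m' by (auto simp: opens_at_most_def opens_at_least_def)
  have sp: "space m = UNIV" using sm(1) by (metis sets_eq_imp_space_eq space_site_fields)
  have UN: "(\<Union>k. large_cluster_event i n k) \<in> sets site_fields" for n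
    using large_cluster_measurable by auto
  have fin: "measure m (large_cluster_event i n k) \<le> measure m' (large_cluster_event i n k)" for n k
  proof -
    have "UNIV \<in> sets m" using sets.top[of m] sp by simp
    then show ?thesis
      using domination_finite[OF m m' finite_to_nat_less increasing_large_cluster
          determined_large_cluster, of UNIV] m.prob_space sp
      by (simp add: insensitive_def)
  qed
  have inc: "incseq (large_cluster_event i n)" for n
  proof (intro monoI subsetI)
    fix k l :: nat and w assume "k \<le> l" "w \<in> large_cluster_event i n k"
    then show "w \<in> large_cluster_event i n l"
      using card_mono[OF finite_truncated_cluster truncated_cluster_mono[of w w k l i]]
      by (auto simp: large_cluster_event_def)
  qed
  have union: "measure m (\<Union>k. large_cluster_event i n k) \<le> measure m' (\<Union>k. large_cluster_event i n k)" for n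
  proof (rule LIMSEQ_le)
    show "(\<lambda>k. measure m (large_cluster_event i n k)) \<longlonglongrightarrow> measure m (\<Union>k. large_cluster_event i n k)"
      by (rule m.finite_Lim_measure_incseq[OF _ inc]) (auto simp: sm large_cluster_measurable)
    show "(\<lambda>k. measure m' (large_cluster_event i n k)) \<longlonglongrightarrow> measure m' (\<Union>k. large_cluster_event i n k)"
      by (rule m'.finite_Lim_measure_incseq[OF _ inc]) (auto simp: sm large_cluster_measurable)
  qed (use fin in blast)
  have dec: "decseq (\<lambda>n. \<Union>k. large_cluster_event i n k)"
    unfolding large_cluster_event_def by (intro antimonoI UN_mono) auto
  show ?thesis
    unfolding infinite_cluster_event
  proof (rule LIMSEQ_le)
    show "(\<lambda>n. measure m (\<Union>k. large_cluster_event i n k)) \<longlonglongrightarrow> measure m (\<Inter>n. \<Union>k. large_cluster_event i n k)"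
      by (rule m.finite_Lim_measure_decseq[OF _ dec]) (use UN sm in auto)
    show "(\<lambda>n. measure m' (\<Union>k. large_cluster_event i n k)) \<longlonglongrightarrow> measure m' (\<Inter>n. \<Union>k. large_cluster_event i n k)"
      by (rule m'.finite_Lim_measure_decseq[OF _ dec]) (use UN sm in auto)
  qed (use union in blast)
qed

section \<open>Product measures\<close>

lemma PiM_insensitive:
  fixes M :: "'i \<Rightarrow> 'a measure"
  assumes M: "\<And>i. prob_space (M i)" and A: "A \<in> sets (M i)"
    and B: "B \<in> sets (PiM UNIV M)" "insensitive i (space (M i)) B"
  shows "measure (PiM UNIV M) ({x \<in> space (PiM UNIV M). x i \<in> A} \<inter> B) =
    measure (M i) A * measure (PiM UNIV M) B"
proof -
  let ?N = "PiM UNIV M"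
  interpret Mi: prob_space "M i" by (rule M)
  interpret N: prob_space ?N by (intro prob_space_PiM M)
  interpret pair_prob_space "M i" ?N ..
  let ?f = "\<lambda>(a, X). X(i := a)" and ?S = "{x \<in> space ?N. x i \<in> A} \<inter> B"
  have distr: "distr (M i \<Otimes>\<^sub>M ?N) ?N ?f = ?N"
    using distr_pair_PiM_eq_PiM[of UNIV M i] M by simp
  have S: "?S \<in> sets ?N"
  proof -
    have "{x \<in> space ?N. x i \<in> A} \<in> sets ?N"
      using A by measurable
    then show ?thesis using B by auto
  qed
  have f: "?f \<in> M i \<Otimes>\<^sub>M ?N \<rightarrow>\<^sub>M ?N"
    using measurable_fun_upd[of UNIV UNIV i snd "M i \<Otimes>\<^sub>M ?N" M fst]
    by (simp add: case_prod_beta)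
  have pre: "?f -` ?S \<inter> space (M i \<Otimes>\<^sub>M ?N) = A \<times> B"
  proof -
    have iff: "X(i := a) \<in> B \<longleftrightarrow> X \<in> B" if "a \<in> space (M i)" "X \<in> space ?N" for a X
    proof
      assume "X(i := a) \<in> B"
      moreover have "X i \<in> space (M i)" using that by (auto simp: space_PiM)
      ultimately have "(X(i := a))(i := X i) \<in> B" using B(2) unfolding insensitive_def by blast
      then show "X \<in> B" by simp
    qed (use B(2) that in \<open>auto simp: insensitive_def\<close>)
    have upd: "X(i := a) \<in> space ?N" if "a \<in> space (M i)" "X \<in> space ?N" for a X
      using that by (auto simp: space_PiM PiE_iff)
    have sub: "a \<in> A \<Longrightarrow> a \<in> space (M i)" "X \<in> B \<Longrightarrow> X \<in> space ?N" for a X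
      using sets.sets_into_space[OF A] sets.sets_into_space[OF B(1)] by auto
    have "?f -` ?S \<inter> space (M i \<Otimes>\<^sub>M ?N) = {(a, X). a \<in> space (M i) \<and> X \<in> space ?N \<and>
        X(i := a) \<in> space ?N \<and> a \<in> A \<and> X(i := a) \<in> B}"
      by (auto simp: space_pair_measure)
    also have "\<dots> = A \<times> B" by (rule set_eqI) (auto simp: iff upd sub)
    finally show ?thesis .
  qed
  have "measure ?N ?S = measure (distr (M i \<Otimes>\<^sub>M ?N) ?N ?f) ?S" by (simp only: distr)
  also have "\<dots> = measure (M i \<Otimes>\<^sub>M ?N) (A \<times> B)"
    using measure_distr[OF f S] pre by simp
  also have "\<dots> = measure (M i) A * measure ?N B"
    using N.emeasure_pair_measure_Times[OF A B(1)] by (simp add: measure_def enn2real_mult)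
  finally show ?thesis .
qed

lemma pair_measure_slices_fst:
  assumes "prob_space M1" "prob_space M2"
    and V: "V \<in> sets (M1 \<Otimes>\<^sub>M M2)" and W: "W \<in> sets (M1 \<Otimes>\<^sub>M M2)" and "0 \<le> a" "0 \<le> b"
    and le: "\<And>y. y \<in> space M2 \<Longrightarrow>
      a * measure M1 ((\<lambda>x. (x, y)) -` V) \<le> b * measure M1 ((\<lambda>x. (x, y)) -` W)"
  shows "a * measure (M1 \<Otimes>\<^sub>M M2) V \<le> b * measure (M1 \<Otimes>\<^sub>M M2) W"
proof -
  interpret M1: prob_space M1 by fact
  interpret M2: prob_space M2 by fact
  interpret pair_prob_space M1 M2 ..
  have "ennreal a * emeasure (M1 \<Otimes>\<^sub>M M2) V = (\<integral>\<^sup>+y. ennreal a * emeasure M1 ((\<lambda>x. (x, y)) -` V) \<partial>M2)"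
    using emeasure_pair_measure_alt2[OF V] measurable_emeasure_Pair2[OF V]
    by (simp add: nn_integral_cmult)
  also have "\<dots> \<le> (\<integral>\<^sup>+y. ennreal b * emeasure M1 ((\<lambda>x. (x, y)) -` W) \<partial>M2)"
    by (rule nn_integral_mono)
      (use le \<open>0 \<le> a\<close> \<open>0 \<le> b\<close> in \<open>simp add: M1.emeasure_eq_measure flip: ennreal_mult\<close>)
  also have "\<dots> = ennreal b * emeasure (M1 \<Otimes>\<^sub>M M2) W"
    using emeasure_pair_measure_alt2[OF W] measurable_emeasure_Pair2[OF W]
    by (simp add: nn_integral_cmult)
  finally show ?thesis
    using \<open>0 \<le> a\<close> \<open>0 \<le> b\<close> by (simp add: emeasure_eq_measure flip: ennreal_mult)
qed

lemma pair_measure_slices_snd: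
  assumes "prob_space M1" "prob_space M2"
    and V: "V \<in> sets (M1 \<Otimes>\<^sub>M M2)" and W: "W \<in> sets (M1 \<Otimes>\<^sub>M M2)" and "0 \<le> a"
    and eq: "\<And>x. x \<in> space M1 \<Longrightarrow> measure M2 (Pair x -` V) = a * measure M2 (Pair x -` W)"
  shows "measure (M1 \<Otimes>\<^sub>M M2) V = a * measure (M1 \<Otimes>\<^sub>M M2) W"
proof -
  interpret M1: prob_space M1 by fact
  interpret M2: prob_space M2 by fact
  interpret pair_prob_space M1 M2 ..
  have "emeasure (M1 \<Otimes>\<^sub>M M2) V = (\<integral>\<^sup>+x. emeasure M2 (Pair x -` V) \<partial>M1)"
    by (rule M2.emeasure_pair_measure_alt[OF V])
  also have "\<dots> = (\<integral>\<^sup>+x. ennreal a * emeasure M2 (Pair x -` W) \<partial>M1)"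
    by (rule nn_integral_cong)
      (use eq \<open>0 \<le> a\<close> in \<open>simp add: M2.emeasure_eq_measure flip: ennreal_mult\<close>)
  also have "\<dots> = ennreal a * emeasure (M1 \<Otimes>\<^sub>M M2) W"
    using M2.emeasure_pair_measure_alt[OF W] M2.measurable_emeasure_Pair[OF W]
    by (simp add: nn_integral_cmult)
  finally show ?thesis
    using \<open>0 \<le> a\<close> by (simp add: emeasure_eq_measure flip: ennreal_mult)
qed

section \<open>Percolation\<close>

lemma sets_percolation: "sets (percolation p) = sets site_fields"
  unfolding percolation_def by (intro sets_PiM_cong) auto

lemma prob_space_percolation: "prob_space (percolation p)"
  unfolding percolation_def by (intro prob_space_PiM measure_pmf.prob_space_axioms)

lemma percolation_open:
  assumes "0 \<le> p" "p \<le> 1" "C \<in> sets (percolation p)" "insensitive i UNIV C"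
  shows "measure (percolation p) ({w. w i} \<inter> C) = p * measure (percolation p) C"
proof -
  let ?M = "\<lambda>i::site. measure_pmf (bernoulli_pmf p)"
  have "measure (PiM UNIV ?M) ({x \<in> space (PiM UNIV ?M). x i \<in> {True}} \<inter> C) =
      measure (?M i) {True} * measure (PiM UNIV ?M) C"
    by (rule PiM_insensitive)
      (use assms in \<open>auto simp: percolation_def measure_pmf.prob_space_axioms\<close>)
  then show ?thesis
    using assms(1,2) by (simp add: percolation_def space_PiM measure_pmf_single)
qed

lemma percolation_opens_at_most: "0 \<le> p \<Longrightarrow> p \<le> q \<Longrightarrow> p \<le> 1 \<Longrightarrow> opens_at_most q (percolation p)"
  unfolding opens_at_most_def
  by (auto simp: sets_percolation prob_space_percolation percolation_open mult_right_mono)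

lemma percolation_opens_at_least: "0 \<le> p \<Longrightarrow> p \<le> 1 \<Longrightarrow> opens_at_least p (percolation p)"
  unfolding opens_at_least_def
  by (auto simp: sets_percolation prob_space_percolation percolation_open)

lemma AE_no_infinite_cluster_iff:
  "(AE w in percolation p. \<not> (\<exists>i. w i \<and> infinite (open_cluster w i))) \<longleftrightarrow>
    (\<forall>i. measure (percolation p) {w. infinite (open_cluster w i)} = 0)"
proof -
  interpret prob_space "percolation p" by (rule prob_space_percolation)
  have "(AE w in percolation p. \<not> (\<exists>i. w i \<and> infinite (open_cluster w i))) \<longleftrightarrow>
      (\<forall>i. AE w in percolation p. w \<notin> {w. infinite (open_cluster w i)})"
    unfolding AE_all_countable[symmetric] mem_Collect_eq
    using infinite_open_cluster_open by (intro AE_cong) blast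
  also have "\<dots> \<longleftrightarrow> (\<forall>i. measure (percolation p) {w. infinite (open_cluster w i)} = 0)"
    using infinite_cluster_measurable
    by (subst AE_iff_null_sets[symmetric])
      (auto simp: sets_percolation null_sets_def emeasure_eq_measure)
  finally show ?thesis .
qed

lemma percolation_set_bdd:
  "bdd_above {p \<in> {0..1}. AE w in percolation p. \<not> (\<exists>i. w i \<and> infinite (open_cluster w i))}"
  by (rule bdd_aboveI[of _ 1]) auto

lemma infinite_cluster_null_below_p_crit:
  assumes "opens_at_most p m" "p < p_crit"
  shows "measure m {w. infinite (open_cluster w i)} = 0"
proof -
  let ?S = "{p \<in> {0..1}. AE w in percolation p. \<not> (\<exists>i. w i \<and> infinite (open_cluster w i))}"
  interpret p0: prob_space "percolation 0" by (rule prob_space_percolation)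
  have "measure (percolation 0) {w. infinite (open_cluster w j)} = 0" for j
  proof -
    have sp: "space (percolation 0) = UNIV"
      using sets_eq_imp_space_eq[OF sets_percolation[of 0]] by (simp add: space_site_fields)
    then have "measure (percolation 0) {w. w j} = 0"
      using percolation_open[of 0 UNIV j] sets.top[of "percolation 0"] by (simp add: insensitive_def)
    moreover have "measure (percolation 0) {w. infinite (open_cluster w j)} \<le> measure (percolation 0) {w. w j}"
    proof (rule p0.finite_measure_mono)
      show "{w. infinite (open_cluster w j)} \<subseteq> {w. w j}"
        using infinite_open_cluster_open by blast
    qed (simp add: sets_percolation site_open_measurable)
    ultimately show ?thesis by (simp add: measure_le_0_iff)
  qed
  then have "0 \<in> ?S" unfolding mem_Collect_eq AE_no_infinite_cluster_iff by simp
  then have "?S \<noteq> {}" by blast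
  then have "\<exists>q\<in>?S. p < q"
    using assms(2) less_cSup_iff[OF _ percolation_set_bdd, THEN iffD1] unfolding p_crit_def by blast
  then obtain q where q: "q \<in> ?S" "p < q" by blast
  have "opens_at_most q m"
    using assms(1) q(2) unfolding opens_at_most_def
    by (meson less_imp_le measure_nonneg mult_right_mono order_trans)
  then have "measure m {w. infinite (open_cluster w i)}
      \<le> measure (percolation q) {w. infinite (open_cluster w i)}"
    by (rule infinite_cluster_domination) (use q in \<open>auto intro: percolation_opens_at_least\<close>)
  also have "\<dots> = 0" using q(1) unfolding mem_Collect_eq AE_no_infinite_cluster_iff by blast
  finally show ?thesis by (simp add: measure_le_0_iff)
qed

lemma infinite_cluster_pos_above_p_crit:
  assumes "opens_at_least p m" "p_crit < p" "0 \<le> p" "p \<le> 1"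
  shows "\<exists>i. 0 < measure m {w. infinite (open_cluster w i)}"
proof -
  have "p \<notin> {p \<in> {0..1}. AE w in percolation p. \<not> (\<exists>i. w i \<and> infinite (open_cluster w i))}"
    using assms(2) cSup_upper[OF _ percolation_set_bdd, of p] unfolding p_crit_def by linarith
  then obtain i where "measure (percolation p) {w. infinite (open_cluster w i)} \<noteq> 0"
    using assms(3,4) unfolding mem_Collect_eq AE_no_infinite_cluster_iff by fastforce
  then have "0 < measure (percolation p) {w. infinite (open_cluster w i)}"
    by (simp add: zero_less_measure_iff)
  also have "\<dots> \<le> measure m {w. infinite (open_cluster w i)}"
    by (rule infinite_cluster_domination[OF percolation_opens_at_most assms(1)]) (use assms in auto)
  finally show ?thesis by blast
qed

section \<open>The diluted field\<close>

lemma insensitive_in_coord_algebra: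
  assumes "B \<in> sets config_space" "insensitive i spins B"
  shows "B \<in> sets (coord_algebra (- {i}))"
proof -
  let ?G = "{{x \<in> configs. x j \<in> B} |j B. j \<in> - {i} \<and> B \<subseteq> spins}"
  let ?N = "coord_algebra (- {i})"
  have sp: "space ?N = configs"
    unfolding coord_algebra_def by (rule space_measure_of) auto
  have gen: "{x \<in> configs. x j \<in> A} \<in> sets ?N" if "j \<noteq> i" "A \<subseteq> spins" for j A
  proof -
    have "?G \<subseteq> Pow configs" by auto
    moreover have "{x \<in> configs. x j \<in> A} \<in> ?G" 
      using that by (intro CollectI exI[of _ j] exI[of _ A] conjI) simp_all
    ultimately show ?thesis unfolding coord_algebra_def by (simp add: sets_measure_of)
  qed
  have val: "x j \<in> spins" if "x \<in> configs" for x j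
    using that unfolding config_space_def by (auto simp: space_PiM)
  have one: "1 \<in> spins" by (simp add: spins_def)
  have "(\<lambda>x. x(i := 1)) \<in> ?N \<rightarrow>\<^sub>M config_space"
    unfolding config_space_def
  proof (rule measurable_PiM_single')
    fix j :: site
    show "(\<lambda>x. (x(i := 1)) j) \<in> ?N \<rightarrow>\<^sub>M count_space spins"
    proof (cases "j = i")
      case True then show ?thesis by (simp add: spins_def)
    next
      case False
      then show ?thesis
        using gen[OF False] val
        by (intro measurableI) (simp_all add: sp vimage_def Int_def conj_commute)
    qed
  qed (use val in \<open>auto simp: sp one\<close>)
  then have "(\<lambda>x. x(i := 1)) -` B \<inter> space ?N \<in> sets ?N"
    using assms(1) by (rule measurable_sets)
  also have "(\<lambda>x. x(i := 1)) -` B \<inter> space ?N = B"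
  proof (intro equalityI subsetI)
    fix x assume x: "x \<in> (\<lambda>x. x(i := 1)) -` B \<inter> space ?N"
    then have "(x(i := 1))(i := x i) \<in> B"
      using assms(2) val[of x i] unfolding insensitive_def sp by blast
    then show "x \<in> B" by simp
  next
    fix x assume "x \<in> B"
    then show "x \<in> (\<lambda>x. x(i := 1)) -` B \<inter> space ?N"
      using assms sets.sets_into_space[OF assms(1)] by (auto simp: insensitive_def sp spins_def)
  qed
  finally show ?thesis .
qed

lemma config_coord_measurable: "{x \<in> configs. x i = a} \<in> sets config_space"
proof -
  have "(\<lambda>x. x i) \<in> config_space \<rightarrow>\<^sub>M count_space spins"
    unfolding config_space_def by measurable
  then have "(\<lambda>x. x i) -` ({a} \<inter> spins) \<inter> configs \<in> sets config_space"
    by (rule measurable_sets) simp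
  also have "(\<lambda>x. x i) -` ({a} \<inter> spins) \<inter> configs = {x \<in> configs. x i = a}"
    unfolding config_space_def by (auto simp: space_PiM)
  finally show ?thesis .
qed

lemma configs_nonempty: "configs \<noteq> {}"
proof -
  have "(\<lambda>_. 1) \<in> configs" by (simp add: configs_iff)
  then show ?thesis by blast
qed

lemma
  assumes "gibbs_spec P"
  shows prob_space_spec: "x \<in> configs \<Longrightarrow> prob_space (P {i} x)"
    and sets_spec: "x \<in> configs \<Longrightarrow> sets (P {i} x) = sets config_space"
  using assms unfolding gibbs_spec_def
  by (auto dest!: spec[of _ "{i}"] measurable_space simp: space_prob_algebra)

lemma lambda0_le:
  assumes "gibbs_spec P" "x \<in> configs"
  shows "lambda0 P a \<le> single_site P i a x"
proof -
  have "lambda0 P a \<le> (INF x\<in>configs. single_site P i a x)"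
    unfolding lambda0_def
  proof (rule cINF_lower)
    show "bdd_below (range (\<lambda>i. INF x\<in>configs. single_site P i a x))"
      by (rule bdd_belowI[of _ 0])
        (auto intro!: cINF_greatest configs_nonempty simp: single_site_def)
  qed simp
  also have "\<dots> \<le> single_site P i a x"
    by (rule cINF_lower[OF _ assms(2)], rule bdd_belowI[of _ 0]) (auto simp: single_site_def)
  finally show ?thesis .
qed

lemma lambda0_nonneg: "0 \<le> lambda0 P a"
  unfolding lambda0_def
  by (intro cINF_greatest configs_nonempty) (auto simp: single_site_def)

lemma lambda0_le_1:
  assumes "gibbs_spec P"
  shows "lambda0 P a \<le> 1"
proof -
  obtain x where x: "x \<in> configs" using configs_nonempty by blast
  show ?thesis
    using lambda0_le[OF assms x, of a "(0,0)"] prob_space.prob_le_1[OF prob_space_spec[OF assms x]]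
    unfolding single_site_def by (rule order_trans)
qed

lemma gibbs_insensitive_ge:
  assumes P: "gibbs_spec P" and \<mu>: "\<mu> \<in> gibbs_measures P"
    and B: "B \<in> sets config_space" "insensitive i spins B"
  shows "lambda0 P a * measure \<mu> B \<le> measure \<mu> ({x \<in> configs. x i = a} \<inter> B)"
proof -
  let ?A = "{x \<in> configs. x i = a}"
  have sets: "sets \<mu> = sets config_space" and "prob_space \<mu>"
    using \<mu> by (auto simp: gibbs_measures_def space_prob_algebra)
  interpret prob_space \<mu> by fact
  have space: "space \<mu> = configs" using sets by (rule sets_eq_imp_space_eq)
  have AB: "?A \<inter> B \<in> sets config_space" using B(1) config_coord_measurable by auto
  have kernel: "measure (P {i} x) (?A \<inter> B) = indicator B x * single_site P i a x" if x: "x \<in> configs" for x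
  proof -
    interpret Px: prob_space "P {i} x" by (rule prob_space_spec[OF P x])
    have sPx: "sets (P {i} x) = sets config_space" by (rule sets_spec[OF P x])
    have ind: "measure (P {i} x) B = indicator B x"
      using P insensitive_in_coord_algebra[OF B] x unfolding gibbs_spec_def by auto
    show ?thesis
    proof (cases "x \<in> B")
      case True
      then have "AE y in P {i} x. y \<in> B"
        using Px.prob_eq_1[of B] ind B(1) sPx by auto
      then have "measure (P {i} x) (?A \<inter> B) = measure (P {i} x) ?A"
        using AB config_coord_measurable sPx by (intro Px.finite_measure_eq_AE) auto
      then show ?thesis using True by (simp add: single_site_def)
    next
      case False
      have "measure (P {i} x) (?A \<inter> B) \<le> measure (P {i} x) B"
        using B(1) sPx by (intro Px.finite_measure_mono) auto
      then show ?thesis using ind False by (simp add: measure_le_0_iff)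
    qed
  qed
  have meas: "(\<lambda>x. measure (P {i} x) (?A \<inter> B)) \<in> borel_measurable \<mu>"
  proof -
    have "P {i} \<in> config_space \<rightarrow>\<^sub>M prob_algebra config_space"
      using P by (simp add: gibbs_spec_def)
    from measurable_compose[OF this measurable_measure_prob_algebra[OF AB]]
    show ?thesis using sets measurable_cong_sets by blast
  qed
  have "lambda0 P a * measure \<mu> B = (\<integral>x. lambda0 P a * indicator B x \<partial>\<mu>)"
    using B(1) sets by simp
  also have "\<dots> \<le> (\<integral>x. measure (P {i} x) (?A \<inter> B) \<partial>\<mu>)"
  proof (rule integral_mono)
    show "integrable \<mu> (\<lambda>x. lambda0 P a * indicator B x)"
      using B(1) sets by (auto simp: emeasure_eq_measure)
    show "integrable \<mu> (\<lambda>x. measure (P {i} x) (?A \<inter> B))"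
    proof (rule integrable_const_bound[where B = 1, OF AE_I2 meas])
      fix x assume "x \<in> space \<mu>"
      then show "norm (measure (P {i} x) (?A \<inter> B)) \<le> 1"
        using prob_space.prob_le_1[OF prob_space_spec[OF P]] space by simp
    qed
    fix x assume "x \<in> space \<mu>"
    then show "lambda0 P a * indicator B x \<le> measure (P {i} x) (?A \<inter> B)"
      using kernel lambda0_le[OF P] space by (auto simp: indicator_def)
  qed
  also have "\<dots> = measure \<mu> (?A \<inter> B)"
    using \<mu> AB unfolding gibbs_measures_def by auto
  finally show ?thesis .
qed

lemma gibbs_insensitive_le:
  assumes P: "gibbs_spec P" and \<mu>: "\<mu> \<in> gibbs_measures P"
    and B: "B \<in> sets config_space" "insensitive i spins B"
  shows "measure \<mu> ({x \<in> configs. x i = 1} \<inter> B) \<le> (1 - lambda0 P (-1)) * measure \<mu> B"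
proof -
  have sets: "sets \<mu> = sets config_space" and "prob_space \<mu>"
    using \<mu> by (auto simp: gibbs_measures_def space_prob_algebra)
  interpret prob_space \<mu> by fact
  have sub: "B \<subseteq> configs" using B(1) by (rule sets.sets_into_space)
  have "x i = 1 \<or> x i = -1" if "x \<in> configs" for x
    using that unfolding configs_iff by blast
  with sub have "B = ({x \<in> configs. x i = 1} \<inter> B) \<union> ({x \<in> configs. x i = -1} \<inter> B)" by blast
  then have "measure \<mu> B = measure \<mu> (({x \<in> configs. x i = 1} \<inter> B) \<union> ({x \<in> configs. x i = -1} \<inter> B))"
    by (rule arg_cong)
  also have "\<dots> = measure \<mu> ({x \<in> configs. x i = 1} \<inter> B) + measure \<mu> ({x \<in> configs. x i = -1} \<inter> B)"
    using B(1) sets config_coord_measurable by (intro finite_measure_Union) auto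
  finally show ?thesis
    using gibbs_insensitive_ge[OF assms, of "-1"] by (simp add: algebra_simps)
qed

abbreviation noise_site :: "real \<Rightarrow> int measure" where
  "noise_site \<epsilon> \<equiv> point_measure spins (\<lambda>a. if a = -1 then ennreal \<epsilon> else ennreal (1 - \<epsilon>))"

lemma prob_space_noise_site:
  assumes "0 < \<epsilon>" "\<epsilon> < 1"
  shows "prob_space (noise_site \<epsilon>)"
proof
  have "emeasure (noise_site \<epsilon>) spins = ennreal \<epsilon> + ennreal (1 - \<epsilon>)"
    by (subst emeasure_point_measure_finite) (auto simp: spins_def)
  also have "\<dots> = 1" using assms by (simp flip: ennreal_plus)
  finally show "emeasure (noise_site \<epsilon>) (space (noise_site \<epsilon>)) = 1"
    by (simp add: space_point_measure)
qed

lemma sets_noise: "sets (noise \<epsilon>) = sets config_space"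
  unfolding noise_def config_space_def by (intro sets_PiM_cong) (auto simp: sets_point_measure)

lemma prob_space_noise: "0 < \<epsilon> \<Longrightarrow> \<epsilon> < 1 \<Longrightarrow> prob_space (noise \<epsilon>)"
  unfolding noise_def by (intro prob_space_PiM prob_space_noise_site)

lemma noise_plus:
  assumes "0 < \<epsilon>" "\<epsilon> < 1" "B \<in> sets config_space" "insensitive i spins B"
  shows "measure (noise \<epsilon>) ({x \<in> configs. x i = 1} \<inter> B) = (1 - \<epsilon>) * measure (noise \<epsilon>) B"
proof -
  have "measure (noise \<epsilon>) ({x \<in> space (noise \<epsilon>). x i \<in> {1}} \<inter> B) =
      measure (noise_site \<epsilon>) {1} * measure (noise \<epsilon>) B"
    unfolding noise_def
  proof (rule PiM_insensitive)
    show "prob_space (noise_site \<epsilon>)" using assms by (intro prob_space_noise_site)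
    show "{1} \<in> sets (noise_site \<epsilon>)" by (simp add: sets_point_measure spins_def)
    show "B \<in> sets (PiM UNIV (\<lambda>_. noise_site \<epsilon>))" using assms(3) sets_noise[of \<epsilon>] by (simp add: noise_def)
    show "insensitive i (space (noise_site \<epsilon>)) B" using assms(4) by (simp add: space_point_measure)
  qed
  moreover have "measure (noise_site \<epsilon>) {1} = 1 - \<epsilon>"
    unfolding measure_def
    by (subst emeasure_point_measure_finite) (use assms in \<open>auto simp: spins_def\<close>)
  ultimately show ?thesis
    using sets_eq_imp_space_eq[OF sets_noise[of \<epsilon>]] by simp
qed

lemma diluted_map_measurable:
  "(\<lambda>(x1, x2) i. min (x1 i) (x2 i)) \<in> config_space \<Otimes>\<^sub>M config_space \<rightarrow>\<^sub>M config_space"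
proof -
  have "(\<lambda>z i. min (fst z i) (snd z i)) \<in> config_space \<Otimes>\<^sub>M config_space \<rightarrow>\<^sub>M config_space"
    unfolding config_space_def
  proof (rule measurable_PiM_single')
    fix i :: site
    let ?X = "\<Pi>\<^sub>M i\<in>(UNIV :: site set). count_space spins"
    have "(\<lambda>z. (fst z i, snd z i)) \<in> ?X \<Otimes>\<^sub>M ?X \<rightarrow>\<^sub>M count_space spins \<Otimes>\<^sub>M count_space spins"
      by measurable
    also have "count_space spins \<Otimes>\<^sub>M count_space spins = count_space (spins \<times> spins)"
      by (rule pair_measure_countable) (auto simp: spins_def)
    finally have "(\<lambda>z. (fst z i, snd z i)) \<in> ?X \<Otimes>\<^sub>M ?X \<rightarrow>\<^sub>M count_space (spins \<times> spins)" .
    moreover have "(\<lambda>(a, b). min a b) \<in> count_space (spins \<times> spins) \<rightarrow>\<^sub>M count_space spins"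
      by (auto simp: spins_def min_def)
    ultimately have "(\<lambda>(a, b). min a b) \<circ> (\<lambda>z. (fst z i, snd z i)) \<in> ?X \<Otimes>\<^sub>M ?X \<rightarrow>\<^sub>M count_space spins"
      by (rule measurable_comp)
    then show "(\<lambda>z. min (fst z i) (snd z i)) \<in> ?X \<Otimes>\<^sub>M ?X \<rightarrow>\<^sub>M count_space spins"
      by (simp add: comp_def)
  qed (auto simp: space_pair_measure space_PiM min_def PiE_iff)
  then show ?thesis by (simp add: case_prod_beta')
qed

lemma minus_sites_measurable: "minus_sites \<in> config_space \<rightarrow>\<^sub>M site_fields"
  unfolding config_space_def
proof (rule measurable_PiM_single')
  fix i :: site
  have "(\<lambda>x. x i) \<in> (\<Pi>\<^sub>M i\<in>(UNIV :: site set). count_space spins) \<rightarrow>\<^sub>M count_space spins"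
    by measurable
  then have "(\<lambda>a. a = -1) \<circ> (\<lambda>x. x i) \<in> (\<Pi>\<^sub>M i\<in>(UNIV :: site set). count_space spins) \<rightarrow>\<^sub>M count_space UNIV"
    by (rule measurable_comp) simp
  then show "(\<lambda>x. minus_sites x i) \<in> (\<Pi>\<^sub>M i\<in>(UNIV :: site set). count_space spins) \<rightarrow>\<^sub>M count_space UNIV"
    by (simp add: comp_def minus_sites_def)
qed auto

definition minus_field :: "config measure \<Rightarrow> real \<Rightarrow> (site \<Rightarrow> bool) measure" where
  "minus_field \<mu> \<epsilon> = distr (diluted \<mu> \<epsilon>) site_fields minus_sites"

text \<open>A site is occupied by \<open>+1\<close> after dilution iff both \<open>\<mu>\<close> and the noise put \<open>+1\<close> there.\<close>

lemma minus_field_bounds: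
  assumes P: "gibbs_spec P" and \<mu>: "\<mu> \<in> gibbs_measures P" and \<epsilon>: "0 < \<epsilon>" "\<epsilon> < 1"
  shows "prob_space (diluted \<mu> \<epsilon>)"
    and "opens_at_most (1 - (1 - \<epsilon>) * lambda0 P 1) (minus_field \<mu> \<epsilon>)"
    and "opens_at_least (\<epsilon> + (1 - \<epsilon>) * lambda0 P (-1)) (minus_field \<mu> \<epsilon>)"
proof -
  have s\<mu>: "sets \<mu> = sets config_space" and "prob_space \<mu>"
    using \<mu> by (auto simp: gibbs_measures_def space_prob_algebra)
  interpret \<mu>: prob_space \<mu> by fact
  interpret \<nu>: prob_space "noise \<epsilon>" using \<epsilon> by (rule prob_space_noise)
  interpret pair_prob_space \<mu> "noise \<epsilon>" ..
  let ?M = "\<mu> \<Otimes>\<^sub>M noise \<epsilon>" and ?f = "\<lambda>(x1, x2) i. min (x1 i) (x2 i :: int)"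
  have sM: "sets ?M = sets (config_space \<Otimes>\<^sub>M config_space)"
    by (intro sets_pair_measure_cong s\<mu> sets_noise)
  have spM: "space ?M = configs \<times> configs"
    using sets_eq_imp_space_eq[OF sM] by (simp add: space_pair_measure)
  have sp: "space \<mu> = configs" "space (noise \<epsilon>) = configs"
    using sets_eq_imp_space_eq[OF s\<mu>] sets_eq_imp_space_eq[OF sets_noise[of \<epsilon>]] by auto
  have f: "?f \<in> ?M \<rightarrow>\<^sub>M config_space"
    using diluted_map_measurable measurable_cong_sets[OF sM refl] by blast
  show D: "prob_space (diluted \<mu> \<epsilon>)"
    unfolding diluted_def by (rule prob_space_distr[OF f])
  have min_sites: "minus_sites \<in> diluted \<mu> \<epsilon> \<rightarrow>\<^sub>M site_fields"
    using minus_sites_measurable by (simp add: diluted_def)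
  have pF: "prob_space (minus_field \<mu> \<epsilon>)"
    unfolding minus_field_def by (rule prob_space.prob_space_distr[OF D min_sites])
  have sF: "sets (minus_field \<mu> \<epsilon>) = sets site_fields" by (simp add: minus_field_def)
  interpret F: prob_space "minus_field \<mu> \<epsilon>" by (rule pF)
  let ?g = "minus_sites \<circ> ?f"
  have g: "?g \<in> ?M \<rightarrow>\<^sub>M site_fields" by (rule measurable_comp[OF f minus_sites_measurable])
  have Fg: "minus_field \<mu> \<epsilon> = distr ?M site_fields ?g"
    unfolding minus_field_def diluted_def by (rule distr_distr[OF minus_sites_measurable f])
  have both: "(1 - \<epsilon>) * lambda0 P 1 * measure (minus_field \<mu> \<epsilon>) C \<le> measure (minus_field \<mu> \<epsilon>) (C - {w. w i})
    \<and> measure (minus_field \<mu> \<epsilon>) (C - {w. w i}) \<le> (1 - \<epsilon>) * (1 - lambda0 P (-1)) * measure (minus_field \<mu> \<epsilon>) C"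
    if C: "C \<in> sets site_fields" "insensitive i UNIV C" for i C
  proof -
    let ?p = "{x \<in> configs. x i = 1}"
    define W where "W = ?g -` C \<inter> space ?M"
    define U where "U = (configs \<times> ?p) \<inter> W"
    define V where "V = (?p \<times> ?p) \<inter> W"
    have W: "W \<in> sets ?M" unfolding W_def by (rule measurable_sets[OF g C(1)])
    have "configs \<times> ?p \<in> sets ?M" "?p \<times> ?p \<in> sets ?M"
      unfolding sM by (auto intro!: pair_measureI config_coord_measurable)
    then have U: "U \<in> sets ?M" and V: "V \<in> sets ?M" using W by (auto simp: U_def V_def)
    have gi: "?g (x1(i := a), x2) = (?g (x1, x2))(i := min a (x2 i) = -1)"
      "?g (x1, x2(i := a)) = (?g (x1, x2))(i := min (x1 i) a = -1)" for x1 x2 a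
      by (auto simp: minus_sites_def fun_eq_iff)
    have cupd: "x(i := a) \<in> configs" if "x \<in> configs" "a \<in> spins" for x a
      using that unfolding config_space_def by (auto simp: space_PiM PiE_iff)
    have Wupd: "(x1(i := a), x2) \<in> W" "(x1, x2(i := a)) \<in> W" if "(x1, x2) \<in> W" "a \<in> spins" for x1 x2 a
    proof -
      have x: "x1 \<in> configs" "x2 \<in> configs" "?g (x1, x2) \<in> C" using that by (auto simp: W_def spM)
      have "?g (x1(i := a), x2) \<in> C" "?g (x1, x2(i := a)) \<in> C"
        unfolding gi using C(2) x(3) unfolding insensitive_def by blast+
      then show "(x1(i := a), x2) \<in> W" "(x1, x2(i := a)) \<in> W"
        using x cupd that(2) unfolding W_def spM by blast+
    qed
    have slice1: "(\<lambda>x. (x, y)) -` W \<in> sets config_space" "insensitive i spins ((\<lambda>x. (x, y)) -` W)" for y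
      using sets_Pair2[OF W, of y] s\<mu> Wupd by (auto simp: insensitive_def)
    have slice2: "Pair x -` W \<in> sets config_space" "insensitive i spins (Pair x -` W)" for x
      using sets_Pair1[OF W, of x] sets_noise[of \<epsilon>] Wupd by (auto simp: insensitive_def)
    have Weq: "measure ?M W = measure (minus_field \<mu> \<epsilon>) C"
      unfolding Fg W_def by (rule measure_distr[OF g C(1), symmetric])
    have "measure (minus_field \<mu> \<epsilon>) (C - {w. w i}) = measure ?M (?g -` (C - {w. w i}) \<inter> space ?M)"
      unfolding Fg using C(1) site_open_measurable[of i] by (intro measure_distr[OF g]) auto
    also have "?g -` (C - {w. w i}) \<inter> space ?M = V"
    proof -
      have "min (x1 i) (x2 i) \<noteq> -1 \<longleftrightarrow> x1 i = 1 \<and> x2 i = 1"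
        if "x1 \<in> configs" "x2 \<in> configs" for x1 x2 :: config
        using that[unfolded configs_iff, rule_format, of i] by (auto simp: min_def)
      then show ?thesis by (auto simp: V_def W_def spM minus_sites_def)
    qed
    finally have Veq: "measure (minus_field \<mu> \<epsilon>) (C - {w. w i}) = measure ?M V" .
    have Ueq: "measure ?M U = (1 - \<epsilon>) * measure ?M W"
    proof (rule pair_measure_slices_snd)
      fix x assume "x \<in> space \<mu>"
      then have "Pair x -` U = ?p \<inter> Pair x -` W" by (auto simp: U_def sp)
      then show "measure (noise \<epsilon>) (Pair x -` U) = (1 - \<epsilon>) * measure (noise \<epsilon>) (Pair x -` W)"
        using noise_plus[OF \<epsilon> slice2] by simp
    qed (use \<epsilon> U W \<mu>.prob_space_axioms \<nu>.prob_space_axioms in auto)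
    have slices: "(\<lambda>x. (x, y)) -` V = ?p \<inter> (\<lambda>x. (x, y)) -` U \<and>
        ((\<lambda>x. (x, y)) -` U = {} \<or> (\<lambda>x. (x, y)) -` U = (\<lambda>x. (x, y)) -` W)" for y
      by (auto simp: U_def V_def W_def spM)
    have "lambda0 P 1 * measure ?M U \<le> 1 * measure ?M V"
    proof (rule pair_measure_slices_fst)
      fix y
      show "lambda0 P 1 * measure \<mu> ((\<lambda>x. (x, y)) -` U) \<le> 1 * measure \<mu> ((\<lambda>x. (x, y)) -` V)"
        using slices[of y] gibbs_insensitive_ge[OF P \<mu> slice1, of 1 y] by auto
    qed (use U V \<mu>.prob_space_axioms \<nu>.prob_space_axioms lambda0_nonneg in auto)
    moreover have "1 * measure ?M V \<le> (1 - lambda0 P (-1)) * measure ?M U"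
    proof (rule pair_measure_slices_fst)
      fix y
      show "1 * measure \<mu> ((\<lambda>x. (x, y)) -` V) \<le> (1 - lambda0 P (-1)) * measure \<mu> ((\<lambda>x. (x, y)) -` U)"
        using slices[of y] gibbs_insensitive_le[OF P \<mu> slice1, of y] by auto
    qed (use U V \<mu>.prob_space_axioms \<nu>.prob_space_axioms lambda0_le_1[OF P] in auto)
    ultimately show ?thesis unfolding Veq Ueq Weq[symmetric] by (simp add: mult.assoc mult.left_commute)
  qed
  have split: "measure (minus_field \<mu> \<epsilon>) ({w. w i} \<inter> C) =
      measure (minus_field \<mu> \<epsilon>) C - measure (minus_field \<mu> \<epsilon>) (C - {w. w i})"
    if "C \<in> sets site_fields" for i C
    using F.finite_measure_Diff'[of C "{w. w i}"] that site_open_measurable[of i]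
    by (simp add: sF Int_commute)
  show "opens_at_most (1 - (1 - \<epsilon>) * lambda0 P 1) (minus_field \<mu> \<epsilon>)"
    unfolding opens_at_most_def
  proof (intro conjI allI ballI impI pF sF)
    fix i C assume "C \<in> sets (minus_field \<mu> \<epsilon>)" "insensitive i UNIV C"
    then show "measure (minus_field \<mu> \<epsilon>) ({w. w i} \<inter> C)
        \<le> (1 - (1 - \<epsilon>) * lambda0 P 1) * measure (minus_field \<mu> \<epsilon>) C"
      using both[of C i] split[of C i] sF by (simp add: left_diff_distrib)
  qed
  show "opens_at_least (\<epsilon> + (1 - \<epsilon>) * lambda0 P (-1)) (minus_field \<mu> \<epsilon>)"
    unfolding opens_at_least_def
  proof (intro conjI allI ballI impI pF sF)
    fix i C assume "C \<in> sets (minus_field \<mu> \<epsilon>)" "insensitive i UNIV C"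
    moreover have "\<epsilon> + (1 - \<epsilon>) * lambda0 P (-1) = 1 - (1 - \<epsilon>) * (1 - lambda0 P (-1))"
      by (simp add: algebra_simps)
    ultimately show "(\<epsilon> + (1 - \<epsilon>) * lambda0 P (-1)) * measure (minus_field \<mu> \<epsilon>) C
        \<le> measure (minus_field \<mu> \<epsilon>) ({w. w i} \<inter> C)"
      using both[of C i] split[of C i] sF by (simp only: left_diff_distrib) simp
  qed
qed

lemma infinite_context_support_measurable:
  "{x \<in> configs. infinite (context_support i x)} \<in> sets config_space"
proof -
  have "(\<lambda>w. w(i := True)) \<in> site_fields \<rightarrow>\<^sub>M site_fields"
    by (rule measurable_fun_upd[where J = UNIV]) auto
  then have "(\<lambda>w. w(i := True)) \<circ> minus_sites \<in> config_space \<rightarrow>\<^sub>M site_fields"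
    by (rule measurable_comp[OF minus_sites_measurable])
  from measurable_sets[OF this infinite_cluster_measurable, of i]
  have "((\<lambda>w. w(i := True)) \<circ> minus_sites) -` {w. infinite (open_cluster w i)} \<inter> configs \<in> sets config_space" .
  also have "((\<lambda>w. w(i := True)) \<circ> minus_sites) -` {w. infinite (open_cluster w i)} \<inter> configs =
      {x \<in> configs. infinite (context_support i x)}"
    by (rule set_eqI) (use infinite_context_support_iff[of _ i] in auto)
  finally show ?thesis .
qed

theorem theorem2:
  fixes P :: "site set \<Rightarrow> config \<Rightarrow> config measure"
    and \<mu> :: "config measure"
    and \<epsilon> :: real
  assumes "gibbs_spec P"
    and "markov_field_order1 P \<mu>"
    and "0 < \<epsilon>" and "\<epsilon> < 1"
  shows "((1 - \<epsilon>) * lambda0 P 1 > 1 - p_crit \<longrightarrow>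
            measure (diluted \<mu> \<epsilon>) (\<Inter>i. {x \<in> configs. finite (context_support i x)}) = 1) \<and>
         (\<epsilon> + (1 - \<epsilon>) * lambda0 P (-1) > p_crit \<longrightarrow>
            measure (diluted \<mu> \<epsilon>) (\<Union>i. {x \<in> configs. infinite (context_support i x)}) > 0)"
proof (intro conjI impI)
  have \<mu>: "\<mu> \<in> gibbs_measures P" using assms(2) by (simp add: markov_field_order1_def)
  note bounds = minus_field_bounds[OF assms(1) \<mu> assms(3,4)]
  let ?D = "diluted \<mu> \<epsilon>" and ?N = "\<lambda>i. {w. infinite (open_cluster w i)}"
  interpret D: prob_space ?D by (rule bounds(1))
  have sD: "sets ?D = sets config_space" by (simp add: diluted_def)
  have spD: "space ?D = configs" using sets_eq_imp_space_eq[OF sD] .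
  have field: "measure (minus_field \<mu> \<epsilon>) (?N i) = measure ?D (minus_sites -` ?N i \<inter> configs)" for i
    unfolding minus_field_def spD[symmetric]
    by (rule measure_distr)
      (use minus_sites_measurable infinite_cluster_measurable in \<open>auto simp: diluted_def\<close>)
  have Nmeas: "minus_sites -` ?N i \<inter> configs \<in> sets ?D" for i
    unfolding sD by (rule measurable_sets[OF minus_sites_measurable infinite_cluster_measurable])
  have Umeas: "(\<Union>i. {x \<in> configs. infinite (context_support i x)}) \<in> sets ?D"
    unfolding sD by (rule sets.countable_UN) (use infinite_context_support_measurable in blast)
  {
    assume "(1 - \<epsilon>) * lambda0 P 1 > 1 - p_crit"
    then have "measure (minus_field \<mu> \<epsilon>) (?N i) = 0" for i
      by (intro infinite_cluster_null_below_p_crit[OF bounds(2)]) simp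
    then have "minus_sites -` ?N i \<inter> configs \<in> null_sets ?D" for i
      using Nmeas[of i] by (simp add: field null_sets_def D.emeasure_eq_measure)
    then have null: "AE x in ?D. \<forall>i. x \<notin> minus_sites -` ?N i \<inter> configs"
      unfolding AE_all_countable by (blast intro: AE_not_in)
    have "AE x in ?D. x \<in> (\<Inter>i. {x \<in> configs. finite (context_support i x)})"
    proof (rule AE_mp[OF null], rule AE_I2, rule impI)
      fix x assume x: "x \<in> space ?D" "\<forall>i. x \<notin> minus_sites -` ?N i \<inter> configs"
      then have "finite (open_cluster (minus_sites x) i)" for i using spD by blast
      then have "finite (open_cluster ((minus_sites x)(i := True)) i)" for i
        using finite_subset[OF open_cluster_force_open] finite_l1_neighbors by simp
      then show "x \<in> (\<Inter>i. {x \<in> configs. finite (context_support i x)})"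
        using infinite_context_support_iff x(1) spD by blast
    qed
    moreover have "(\<Inter>i. {x \<in> configs. finite (context_support i x)}) \<in> sets ?D"
    proof -
      have "(\<Inter>i. {x \<in> configs. finite (context_support i x)}) =
          space ?D - (\<Union>i. {x \<in> configs. infinite (context_support i x)})"
        unfolding spD by blast
      then show ?thesis using sets.compl_sets[OF Umeas] by (simp only:)
    qed
    ultimately show "measure ?D (\<Inter>i. {x \<in> configs. finite (context_support i x)}) = 1"
      using D.prob_eq_1 by blast
  }
  assume "\<epsilon> + (1 - \<epsilon>) * lambda0 P (-1) > p_crit"
  moreover have "\<epsilon> + (1 - \<epsilon>) * lambda0 P (-1) \<le> \<epsilon> + (1 - \<epsilon>) * 1"
    using lambda0_le_1[OF assms(1)] assms(4) by (intro add_left_mono mult_left_mono) auto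
  moreover have "0 \<le> \<epsilon> + (1 - \<epsilon>) * lambda0 P (-1)" using lambda0_nonneg assms(3,4) by simp
  ultimately obtain i where "0 < measure (minus_field \<mu> \<epsilon>) (?N i)"
    using infinite_cluster_pos_above_p_crit[OF bounds(3)] by auto
  also have "measure (minus_field \<mu> \<epsilon>) (?N i) = measure ?D (minus_sites -` ?N i \<inter> configs)"
    by (rule field)
  also have "\<dots> \<le> measure ?D (\<Union>i. {x \<in> configs. infinite (context_support i x)})"
  proof (rule D.finite_measure_mono)
    have "infinite (context_support i x)"
      if "x \<in> configs" "infinite (open_cluster (minus_sites x) i)" for x
    proof -
      have "open_cluster (minus_sites x) i \<subseteq> open_cluster ((minus_sites x)(i := True)) i"
        by (rule open_cluster_mono) simp
      then show ?thesis using that infinite_context_support_iff infinite_super by blast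
    qed
    then show "minus_sites -` ?N i \<inter> configs \<subseteq> (\<Union>i. {x \<in> configs. infinite (context_support i x)})"
      by blast
  qed (rule Umeas)
  finally show "measure ?D (\<Union>i. {x \<in> configs. infinite (context_support i x)}) > 0" .
qed

end
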